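(* For every real $N>0$, $\mathcal{O}_N$ is a finite-dimensional $\mathbf{C}$-vector space, and when $N$ is a positive integer, $$\mathcal{O}_N=\operatorname{Vect}_{u\mid N}\{s\mapsto u^{-s}\},$$ the span over positive divisors $u$ of $N$. In particular $\dim\mathcal{O}_N=d(N)$, where $d(N)$ is the number of positive divisors of $N$ if $N$ is an integer and $0$ otherwise.
   Context: A general Dirichlet series is $\sum_{n\ge1}a_ne^{-\lambda_n s}$ with $(a_n)$ complex and $(\lambda_n)$ non-negative reals strictly increasing to infinity; $\sigma_a(f)$ denotes the abscissa of absolute convergence of the Dirichlet series representing $f$. A meromorphic function $f$ is represented by an ordinary Dirichlet series (ODS) if $f(s)=\sum_{n\ge1}a_nn^{-s}$ for $\operatorname{Re}(s)$ large enough. A function $h$ is of finite order in $\Omega\subseteq\mathbf{C}$ if there exist $\rho>0$, $C>0$ with $|h(s)|\le Ce^{|s|^\rho}$ on $\Omega$. For a positive real $N$, $\mathcal{O}_N$ is the set of functions $f$ such that: (1) $f$ is meromorphic on $\mathbf{C}$ and represented by an ODS; (2) for all $s\in\mathbf{C}$, $f(-s)=N^sg(s)$ where $g$ is represented by an ODS; (3) there exists $M>0$ such that $f$ is of finite order in $\Omega_M(f)=\{-1-\sigma_a(g)\le\operatorname{Re}(s)\le\sigma_a(f)+1\}\cap\{|\operatorname{Im}(s)|\ge M\}$. *)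

theory Defs
  imports "HOL-Complex_Analysis.Complex_Analysis" "HOL-Library.Function_Algebras"
begin

text \<open>
  The complex vector space of all functions from the complex plane to itself, with pointwise
  operations.
\<close>

definition cfun_scale :: "complex \<Rightarrow> (complex \<Rightarrow> complex) \<Rightarrow> complex \<Rightarrow> complex" where
  "cfun_scale c f = (\<lambda>s. c * f s)"

global_interpretation cfun: vector_space cfun_scale
  by unfold_locales (auto simp: cfun_scale_def fun_eq_iff algebra_simps)

text \<open>
  Coefficients are indexed by the positive integers; the value \<open>a 0\<close> is never used.
  A meromorphic function is represented by the total function that is continuous at every
  non-pole and takes the value 0 at every pole (\<open>nicely_meromorphic_on\<close>), so that equality of
  meromorphic functions is equality of functions.
\<close>

definition represented_by_ODS :: "(complex \<Rightarrow> complex) \<Rightarrow> (nat \<Rightarrow> complex) \<Rightarrow> bool" where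
  "represented_by_ODS f a \<longleftrightarrow> f nicely_meromorphic_on UNIV \<and>
     (\<exists>\<sigma>::real. \<forall>s. Re s > \<sigma> \<longrightarrow> (\<lambda>n. a (Suc n) * of_nat (Suc n) powr (-s)) sums f s)"

text \<open>The value is \<open>\<infinity>\<close> if there is no absolute convergence anywhere, and \<open>-\<infinity>\<close> if there is
  absolute convergence everywhere.\<close>

definition abs_abscissa :: "(nat \<Rightarrow> complex) \<Rightarrow> ereal" where
  "abs_abscissa a =
     Inf {ereal \<sigma> |\<sigma>. summable (\<lambda>n. norm (a (Suc n) * of_nat (Suc n) powr (- complex_of_real \<sigma>)))}"

definition finite_order_on :: "(complex \<Rightarrow> complex) \<Rightarrow> complex set \<Rightarrow> bool" where
  "finite_order_on h \<Omega> \<longleftrightarrow>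
     (\<exists>\<rho>>0. \<exists>C>0. \<forall>s\<in>\<Omega>. norm (h s) \<le> C * exp (norm s powr \<rho>))"

text \<open>
  The region in which finite order is required, in terms of the abscissas \<open>\<alpha>\<close> of the function
  and \<open>\<beta>\<close> of its companion. It is empty if one of them is \<open>-\<infinity>\<close>.
  No point of this region is isolated in it, so a function meromorphic on the plane that is of
  finite order there has no poles in it, irrespective of the convention at poles.
\<close>

definition order_region :: "ereal \<Rightarrow> ereal \<Rightarrow> real \<Rightarrow> complex set" where
  "order_region \<alpha> \<beta> M =
     {s. -1 - \<beta> \<le> ereal (Re s) \<and> ereal (Re s) \<le> \<alpha> + 1} \<inter> {s. \<bar>Im s\<bar> \<ge> M}"

text \<open>The function \<open>g\<close> and the coefficients \<open>a\<close>, \<open>b\<close> below are determined by \<open>f\<close>, up to the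
  unused values \<open>a 0\<close> and \<open>b 0\<close>.\<close>

definition ODS_space :: "real \<Rightarrow> (complex \<Rightarrow> complex) set" where
  "ODS_space N = {f. \<exists>a g b.
     represented_by_ODS f a \<and>
     (\<forall>s. f (-s) = of_real N powr s * g s) \<and> represented_by_ODS g b \<and>
     (\<exists>M>0. finite_order_on f (order_region (abs_abscissa a) (abs_abscissa b) M))}"

definition num_divisors :: "real \<Rightarrow> nat" where
  "num_divisors N = (if N \<in> \<nat> then card {u. u dvd nat \<lfloor>N\<rfloor>} else 0)"

end

theory Submission
  imports Defs "HOL-Real_Asymp.Real_Asymp"
begin

text \<open>
  For a positive integer \<open>k\<close>, take a primitive \<open>F\<close> of \<open>f s * k powr s\<close> in an upper half plane without
  poles of \<open>f\<close>. Termwise integration of the series \<open>\<Sum>n. a n * (k / n) powr s\<close> shows that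
  \<open>F (\<sigma> + i t) - i t * a k\<close> is bounded for \<open>t \<rightarrow> \<infinity>\<close> on vertical lines far to the right: only the
  constant term contributes linear growth. Likewise, far to the left the series is
  \<open>\<Sum>m. b m * (m * k / N) powr s\<close>, and the linear term is the sum of the \<open>b m\<close> with \<open>m * k = N\<close>.
  By a Phragmen-Lindelof argument \<open>f\<close> is bounded in the half strip between the two lines, so \<open>F\<close>
  differs by a bounded amount between them and the two linear coefficients agree. Hence \<open>a k\<close>
  vanishes unless \<open>N\<close> is an integer divisible by \<open>k\<close>. The same identity applied to \<open>f = 0\<close> gives
  the linear independence of the functions \<open>u powr (-s)\<close>.
\<close>

subsection \<open>Mean values on vertical lines\<close>

text \<open>A term of frequency \<open>\<mu> n \<noteq> 0\<close> integrates to something of norm at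
  most \<open>norm (c n) / \<delta>\<close>. Thanks to the gap \<open>\<delta>\<close> these bounds
  are summable, so the oscillating part stays bounded for all \<open>t\<close>, and only the terms
  of frequency 0 contribute linear growth.\<close>

lemma growth_of_primitive:
  fixes c :: "nat \<Rightarrow> complex" and \<mu> :: "nat \<Rightarrow> real" and F :: "real \<Rightarrow> complex"
  assumes c: "summable (\<lambda>n. norm (c n))"
    and \<delta>: "\<delta> > 0" "\<And>n. \<mu> n \<noteq> 0 \<Longrightarrow> \<delta> \<le> \<bar>\<mu> n\<bar>"
    and F: "\<And>t. t > M \<Longrightarrow> (F has_vector_derivative (\<Sum>n. c n * cis (\<mu> n * t))) (at t)"
  shows "\<exists>B. \<forall>t>M. norm (F t - t *\<^sub>R (\<Sum>n. if \<mu> n = 0 then c n else 0)) \<le> B"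
proof -
  define A where "A = (\<Sum>n. if \<mu> n = 0 then c n else 0)"
  \<comment> \<open>\<open>p n\<close> is the bounded primitive of \<open>q n\<close>, the
    \<open>n\<close>-th term with frequency 0 removed.\<close>
  define p where "p n t = (if \<mu> n = 0 then 0 else c n * cis (\<mu> n * t) / (\<i> * \<mu> n))" for n t
  define q where "q n t = (if \<mu> n = 0 then 0 else c n * cis (\<mu> n * t))" for n t
  have np: "norm (p n t) \<le> norm (c n) / \<delta>" for n t
    using \<delta> by (auto simp: p_def norm_mult norm_divide intro!: divide_left_mono mult_pos_pos)
  have nq: "norm (q n t) \<le> norm (c n)" for n t
    by (auto simp: q_def norm_mult)
  have sq: "summable (\<lambda>n. q n t)" for t
    by (rule summable_comparison_test'[OF c]) (use nq in auto)
  have sp: "summable (\<lambda>n. norm (p n t))" for t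
    by (rule summable_comparison_test'[OF summable_divide[OF c, of \<delta>]]) (use np in auto)
  have sA: "summable (\<lambda>n. if \<mu> n = 0 then c n else 0)"
    by (rule summable_comparison_test'[OF c]) auto
  have unif: "uniform_limit UNIV (\<lambda>n t. \<Sum>i<n. q i t) (\<lambda>t. \<Sum>n. q n t) sequentially"
    by (rule Weierstrass_m_test[OF _ c]) (use nq in auto)
  \<comment> \<open>Termwise differentiation: the derivatives \<open>q n\<close> converge uniformly
    by the M-test, so convergence of the primitives at the single point 0 suffices.\<close>
  have "\<exists>g. \<forall>t\<in>UNIV. (\<lambda>n. p n t) sums g t \<and> (g has_derivative (\<lambda>h. h *\<^sub>R (\<Sum>n. q n t))) (at t within UNIV)"
  proof (rule has_derivative_series)
    show "(p n has_derivative (\<lambda>h. h *\<^sub>R q n t)) (at t within UNIV)" for n t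
    proof (cases "\<mu> n = 0")
      case False
      then have "((\<lambda>z. c n * exp (\<i> * \<mu> n * z) / (\<i> * \<mu> n)) has_field_derivative
          c n * exp (\<i> * \<mu> n * of_real t)) (at (of_real t))"
        by (auto intro!: derivative_eq_intros simp: field_simps)
      from has_vector_derivative_real_field[OF this] show ?thesis
        using False by (simp add: p_def[abs_def] q_def cis_conv_exp has_vector_derivative_def mult.assoc)
    qed (simp add: p_def[abs_def] q_def)
    show "\<forall>\<^sub>F n in sequentially. \<forall>t\<in>UNIV. \<forall>h. norm ((\<Sum>i<n. h *\<^sub>R q i t) - h *\<^sub>R (\<Sum>n. q n t)) \<le> e * norm h"
      if "e > 0" for e
      using uniform_limitD[OF unif that]
    proof eventually_elim
      case (elim n)
      then have "norm ((\<Sum>i<n. q i t) - (\<Sum>n. q n t)) \<le> e" for t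
        by (auto simp: dist_norm less_imp_le)
      then have "norm (h *\<^sub>R ((\<Sum>i<n. q i t) - (\<Sum>n. q n t))) \<le> e * norm h" for t h
        using mult_right_mono[of "norm ((\<Sum>i<n. q i t) - (\<Sum>n. q n t))" e "norm h"]
        by (simp add: mult.commute)
      then show ?case
        by (simp only: scaleR_sum_right scaleR_diff_right) blast
    qed
    show "(\<lambda>n. p n 0) sums (\<Sum>n. p n 0)"
      by (intro summable_sums summable_norm_cancel[OF sp])
  qed auto
  then obtain g where g: "\<And>t. (\<lambda>n. p n t) sums g t"
      "\<And>t. (g has_vector_derivative (\<Sum>n. q n t)) (at t)"
    unfolding has_vector_derivative_def by blast
  have gB: "norm (g t) \<le> (\<Sum>n. norm (c n) / \<delta>)" for t
  proof -
    have "norm (g t) \<le> (\<Sum>n. norm (p n t))"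
      using summable_norm[OF sp[of t]] sums_unique[OF g(1)[of t]] by simp
    also have "\<dots> \<le> (\<Sum>n. norm (c n) / \<delta>)"
      by (rule suminf_le[OF np sp summable_divide[OF c]])
    finally show ?thesis .
  qed
  have split: "(\<Sum>n. c n * cis (\<mu> n * t)) = A + (\<Sum>n. q n t)" for t
    unfolding A_def suminf_add[OF sA sq] by (intro suminf_cong) (auto simp: q_def)
  \<comment> \<open>\<open>H\<close> has derivative 0 on a half line, hence is constant
    there.\<close>
  define H where "H t = F t - t *\<^sub>R A - g t" for t
  have "(H has_vector_derivative 0) (at t)" if "t > M" for t
    unfolding H_def[abs_def]
    by (rule derivative_eq_intros F[OF that] g refl)+ (simp add: split)
  then have "(H has_derivative (\<lambda>h. 0)) (at t within {M<..})" if "t \<in> {M<..}" for t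
    using that has_derivative_at_withinI by (fastforce simp: has_vector_derivative_def)
  then obtain C where "\<And>t. t \<in> {M<..} \<Longrightarrow> H t = C"
    using has_derivative_zero_constant[of "{M<..}" H] by blast
  then have C: "F t - t *\<^sub>R A = C + g t" if "t > M" for t
    using that by (force simp: H_def algebra_simps)
  have "norm (F t - t *\<^sub>R A) \<le> norm C + (\<Sum>n. norm (c n) / \<delta>)" if "t > M" for t
    unfolding C[OF that] using gB norm_triangle_le add_left_mono by blast
  then show ?thesis unfolding A_def by blast
qed

text \<open>\<open>?A\<close> and \<open>?D\<close> are the mean values of \<open>h\<close> on the
  two vertical lines, that is, the linear growth rates of a primitive along them. As
  \<open>h\<close> is bounded by \<open>K\<close> between the lines, the primitive changes by at
  most \<open>K * (\<sigma> - \<sigma>')\<close> from one to the other at every height, so the rates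
  coincide.\<close>

lemma mean_value_transfer:
  fixes h :: "complex \<Rightarrow> complex" and c d :: "nat \<Rightarrow> complex" and \<mu> \<nu> :: "nat \<Rightarrow> real"
  assumes h: "h holomorphic_on {s. Im s > M}"
    and K: "\<And>s. \<sigma>' \<le> Re s \<Longrightarrow> Re s \<le> \<sigma> \<Longrightarrow> Im s > M \<Longrightarrow> norm (h s) \<le> K"
    and "\<sigma>' \<le> \<sigma>"
    and c: "summable (\<lambda>n. norm (c n))" "\<delta> > 0" "\<And>n. \<mu> n \<noteq> 0 \<Longrightarrow> \<delta> \<le> \<bar>\<mu> n\<bar>"
    and d: "summable (\<lambda>n. norm (d n))" "\<delta>' > 0" "\<And>n. \<nu> n \<noteq> 0 \<Longrightarrow> \<delta>' \<le> \<bar>\<nu> n\<bar>"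
    and hc: "\<And>t. t > M \<Longrightarrow> h (Complex \<sigma> t) = (\<Sum>n. c n * cis (\<mu> n * t))"
    and hd: "\<And>t. t > M \<Longrightarrow> h (Complex \<sigma>' t) = (\<Sum>n. d n * cis (\<nu> n * t))"
  shows "(\<Sum>n. if \<mu> n = 0 then c n else 0) = (\<Sum>n. if \<nu> n = 0 then d n else 0)" (is "?A = ?D")
proof -
  define U where "U = {s. Im s > M}"
  have U: "convex U" "open U"
    unfolding U_def by (simp_all add: convex_halfspace_Im_gt open_halfspace_Im_gt)
  obtain F0 where F0: "\<And>s. s \<in> U \<Longrightarrow> (F0 has_field_derivative h s) (at s within U)"
    using holomorphic_convex_primitive'[OF U, of h] h unfolding U_def by blast
  \<comment> \<open>The factor \<open>- \<i>\<close> cancels the derivative \<open>\<i>\<close> of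
    \<open>Complex x\<close>, so that \<open>F\<close> restricted to a vertical line is a primitive
    of \<open>h\<close> in the real variable \<open>t\<close>.\<close>
  define F where "F s = - \<i> * F0 s" for s
  have F: "(F has_field_derivative (- \<i> * h s)) (at s within U)" if "s \<in> U" for s
    unfolding F_def[abs_def] by (intro DERIV_cmult F0 that)
  have line: "((\<lambda>t. F (Complex x t)) has_vector_derivative h (Complex x t)) (at t)" if "t > M" for x t
  proof -
    have "(F has_field_derivative (- \<i> * h (Complex x t))) (at (Complex x t))"
      using F[of "Complex x t"] at_within_open[OF _ U(2), of "Complex x t"] that by (simp add: U_def)
    moreover have "(Complex x has_vector_derivative \<i>) (at t)"
      unfolding Complex_eq by (auto intro!: derivative_eq_intros)
    ultimately have "((F \<circ> Complex x) has_vector_derivative \<i> * (- \<i> * h (Complex x t))) (at t)"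
      using field_vector_diff_chain_at by blast
    then show ?thesis by (simp add: o_def)
  qed
  have "\<exists>B. \<forall>t>M. norm (F (Complex \<sigma> t) - t *\<^sub>R ?A) \<le> B"
  proof (rule growth_of_primitive[OF c])
    show "((\<lambda>t. F (Complex \<sigma> t)) has_vector_derivative (\<Sum>n. c n * cis (\<mu> n * t))) (at t)"
      if "t > M" for t
      using line[OF that, of \<sigma>] hc[OF that] by simp
  qed
  then obtain B1 where B1: "\<And>t. t > M \<Longrightarrow> norm (F (Complex \<sigma> t) - t *\<^sub>R ?A) \<le> B1"
    by blast
  have "\<exists>B. \<forall>t>M. norm (F (Complex \<sigma>' t) - t *\<^sub>R ?D) \<le> B"
  proof (rule growth_of_primitive[OF d])
    show "((\<lambda>t. F (Complex \<sigma>' t)) has_vector_derivative (\<Sum>n. d n * cis (\<nu> n * t))) (at t)"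
      if "t > M" for t
      using line[OF that, of \<sigma>'] hd[OF that] by simp
  qed
  then obtain B2 where B2: "\<And>t. t > M \<Longrightarrow> norm (F (Complex \<sigma>' t) - t *\<^sub>R ?D) \<le> B2"
    by blast
  have B3: "norm (F (Complex \<sigma> t) - F (Complex \<sigma>' t)) \<le> K * (\<sigma> - \<sigma>')" if t: "t > M" for t
  proof -
    \<comment> \<open>The piece of the strip inside \<open>U\<close> is convex, so the bound on the
      derivative yields a Lipschitz bound for \<open>F\<close> on it.\<close>
    define S where "S = {s. \<sigma>' \<le> Re s} \<inter> {s. Re s \<le> \<sigma>} \<inter> U"
    have "convex S" unfolding S_def
      by (intro convex_Int U convex_halfspace_Re_ge convex_halfspace_Re_le)
    then have "norm (F (Complex \<sigma> t) - F (Complex \<sigma>' t)) \<le> K * norm (Complex \<sigma> t - Complex \<sigma>' t)"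
    proof (rule field_differentiable_bound)
      show "(F has_field_derivative (- \<i> * h s)) (at s within S)" if "s \<in> S" for s
        using F[of s] that by (auto simp: S_def intro: DERIV_subset)
      show "norm (- \<i> * h s) \<le> K" if "s \<in> S" for s
        using K[of s] that by (auto simp: S_def U_def norm_mult)
    qed (use t \<open>\<sigma>' \<le> \<sigma>\<close> in \<open>auto simp: S_def U_def\<close>)
    also have "norm (Complex \<sigma> t - Complex \<sigma>' t) = \<sigma> - \<sigma>'"
      using \<open>\<sigma>' \<le> \<sigma>\<close> by (simp add: cmod_def)
    finally show ?thesis .
  qed
  define B where "B = B1 + B2 + K * (\<sigma> - \<sigma>')"
  have bound: "t * norm (?A - ?D) \<le> B" if t: "t > max M 0" for t
  proof -
    have "t * norm (?A - ?D) = norm (t *\<^sub>R ?A - t *\<^sub>R ?D)"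
      using t by (simp flip: scaleR_diff_right)
    also have "\<dots> = norm ((F (Complex \<sigma>' t) - t *\<^sub>R ?D) - (F (Complex \<sigma> t) - t *\<^sub>R ?A)
        + (F (Complex \<sigma> t) - F (Complex \<sigma>' t)))"
      by (simp add: algebra_simps)
    also have "\<dots> \<le> B2 + B1 + K * (\<sigma> - \<sigma>')"
      using t B1[of t] B2[of t] B3[of t]
        norm_triangle_ineq[of "(F (Complex \<sigma>' t) - t *\<^sub>R ?D) - (F (Complex \<sigma> t) - t *\<^sub>R ?A)" "F (Complex \<sigma> t) - F (Complex \<sigma>' t)"]
        norm_triangle_ineq4[of "F (Complex \<sigma>' t) - t *\<^sub>R ?D" "F (Complex \<sigma> t) - t *\<^sub>R ?A"]
      by linarith
    finally show ?thesis by (simp add: B_def)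
  qed
  have "norm (?A - ?D) = 0"
  proof (rule ccontr)
    assume *: "norm (?A - ?D) \<noteq> 0"
    \<comment> \<open>A height at which the linear growth of the difference has already passed the
      constant \<open>B\<close>.\<close>
    define t where "t = max (max M 0) (B / norm (?A - ?D)) + 1"
    have "B < t * norm (?A - ?D)"
      using * by (simp add: t_def pos_divide_less_eq[symmetric])
    moreover have "t > max M 0"
      using max.cobounded1[of "max M 0" "B / norm (?A - ?D)"] unfolding t_def by linarith
    ultimately show False using bound by fastforce
  qed
  then show ?thesis by simp
qed

subsection \<open>A Phragmen-Lindelof principle\<close>

text \<open>Multiply \<open>f\<close> by a holomorphic factor of norm at most 1 that decays faster
  than \<open>f\<close> can grow, apply the maximum principle on a tall rectangle, and let the
  damping parameter tend to 0. The bound \<open>K\<close> does not depend on that parameter.\<close>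

lemma Phragmen_Lindelof_half_strip:
  fixes f :: "complex \<Rightarrow> complex"
  assumes f: "f holomorphic_on {s. Im s > M}" and "M' > M" and "\<sigma>' < \<sigma>"
    and edge: "\<And>t. t \<ge> M' \<Longrightarrow> norm (f (Complex \<sigma> t)) \<le> B" "\<And>t. t \<ge> M' \<Longrightarrow> norm (f (Complex \<sigma>' t)) \<le> B"
    and fin: "C > 0" "\<rho> > 0" "\<And>s. \<sigma>' \<le> Re s \<Longrightarrow> Re s \<le> \<sigma> \<Longrightarrow> Im s \<ge> M' \<Longrightarrow>
      norm (f s) \<le> C * exp (norm s powr \<rho>)"
  shows "\<exists>K. \<forall>s. \<sigma>' \<le> Re s \<longrightarrow> Re s \<le> \<sigma> \<longrightarrow> Im s \<ge> M' \<longrightarrow> norm (f s) \<le> K"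
proof -
  have cont: "continuous_on {s. Im s > M} f"
    using f holomorphic_on_imp_continuous_on by blast
  have "compact (f ` cbox (Complex \<sigma>' M') (Complex \<sigma> M'))"
    using \<open>M' > M\<close> by (intro compact_continuous_image continuous_on_subset[OF cont])
      (auto simp: in_cbox_complex_iff)
  then obtain B0 where B0: "\<And>s. s \<in> cbox (Complex \<sigma>' M') (Complex \<sigma> M') \<Longrightarrow> norm (f s) \<le> B0"
    by (meson bounded_iff compact_imp_bounded imageI)
  \<comment> \<open>\<open>B\<close> serves the vertical edges and \<open>B0\<close> the bottom
    edge; adding 1 makes \<open>K\<close> strictly positive, so that quantities tending to 0
    eventually fall below it on the top edge.\<close>
  define K where "K = max 0 (max B B0) + 1"
  have K: "K > 0" "B \<le> K" "B0 \<le> K" by (auto simp: K_def)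
  define m where "m = (\<sigma> + \<sigma>') / 2"
  define \<delta> where "\<delta> = 1 / (\<sigma> - \<sigma>')"
  have \<delta>: "\<delta> > 0" using \<open>\<sigma>' < \<sigma>\<close> by (simp add: \<delta>_def)
  define \<kappa> where "\<kappa> = cos (1/2 :: real)"
  have \<kappa>: "\<kappa> > 0" unfolding \<kappa>_def using pi_gt3 by (intro cos_gt_zero) auto
  \<comment> \<open>On the strip \<open>\<bar>\<delta> * (Re s - m)\<bar> \<le> 1/2 < \<pi>/2\<close>, so the damping factor \<open>E\<close> decays doubly exponentially
    and beats every function of finite order.\<close>
  define E where "E \<epsilon> s = exp (- complex_of_real \<epsilon> * cos (of_real \<delta> * (s - of_real m)))" for \<epsilon> s
  have normE: "norm (E \<epsilon> s) \<le> exp (- \<epsilon> * (\<kappa> * exp (\<delta> * Im s) / 2))"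
    if "\<epsilon> > 0" "\<sigma>' \<le> Re s" "Re s \<le> \<sigma>" for \<epsilon> s
  proof -
    have "\<bar>Re s - m\<bar> \<le> (\<sigma> - \<sigma>') / 2"
      unfolding abs_le_iff m_def using that by (simp add: field_simps)
    then have "\<bar>\<delta> * (Re s - m)\<bar> \<le> 1/2"
      using \<open>\<sigma>' < \<sigma>\<close> by (simp add: \<delta>_def abs_mult field_simps)
    then have "\<kappa> \<le> cos \<bar>\<delta> * (Re s - m)\<bar>"
      unfolding \<kappa>_def using pi_gt3 by (intro cos_monotone_0_pi_le) auto
    \<comment> \<open>The right-hand side is the real part of the cosine in \<open>E\<close>; the
      smaller exponential is dropped for the lower bound.\<close>
    then have "\<kappa> * exp (\<delta> * Im s) / 2 \<le> cos (\<delta> * (Re s - m)) * (exp (\<delta> * Im s) + exp (- (\<delta> * Im s))) / 2"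
      using \<kappa> by (intro divide_right_mono mult_mono) auto
    then show ?thesis
      unfolding E_def using that by (simp add: Re_cos mult_left_mono)
  qed
  have main: "norm (f s * E \<epsilon> s) \<le> K" if s: "\<sigma>' \<le> Re s" "Re s \<le> \<sigma>" "Im s \<ge> M'" and \<epsilon>: "\<epsilon> > 0" for s \<epsilon>
  proof -
    \<comment> \<open>\<open>D\<close> bounds \<open>\<bar>Re z\<bar>\<close> in the strip, so
      \<open>norm z \<le> D + R\<close> on the top edge at height \<open>R\<close>.\<close>
    define D where "D = \<bar>\<sigma>\<bar> + \<bar>\<sigma>'\<bar>"
    have "((\<lambda>R. exp ((D + R) powr \<rho> - \<epsilon> * \<kappa> / 2 * exp (\<delta> * R))) \<longlongrightarrow> 0) at_top"
      using \<epsilon> \<kappa> \<delta> \<open>\<rho> > 0\<close> by real_asymp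
    then have "((\<lambda>R. C * exp ((D + R) powr \<rho>) * exp (- \<epsilon> * (\<kappa> * exp (\<delta> * R) / 2))) \<longlongrightarrow> 0) at_top"
      by (auto dest: tendsto_mult_left[of _ 0 _ C] simp: mult.assoc simp flip: exp_add)
    then have "\<forall>\<^sub>F R in at_top. C * exp ((D + R) powr \<rho>) * exp (- \<epsilon> * (\<kappa> * exp (\<delta> * R) / 2)) < K"
      using K(1) by (rule order_tendstoD)
    moreover have "\<forall>\<^sub>F R in at_top. R > max 0 (Im s)" by (rule eventually_gt_at_top)
    ultimately have "\<forall>\<^sub>F R in at_top. R > max 0 (Im s) \<and> C * exp ((D + R) powr \<rho>) * exp (- \<epsilon> * (\<kappa> * exp (\<delta> * R) / 2)) < K"
      by eventually_elim auto
    \<comment> \<open>The top edge is put above \<open>s\<close> and so high that the damping beats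
      the finite order bound there.\<close>
    then obtain R where R: "R > max 0 (Im s)" "C * exp ((D + R) powr \<rho>) * exp (- \<epsilon> * (\<kappa> * exp (\<delta> * R) / 2)) < K"
      using eventually_happens by (metis (no_types, lifting) trivial_limit_at_top_linorder)
    define Q where "Q = cbox (Complex \<sigma>' M') (Complex \<sigma> R)"
    have QM: "Q \<subseteq> {s. Im s > M}" using \<open>M' > M\<close> by (auto simp: Q_def in_cbox_complex_iff)
    have E1: "norm (E \<epsilon> z) \<le> 1" if "z \<in> Q" for z
    proof -
      have "norm (E \<epsilon> z) \<le> exp (- \<epsilon> * (\<kappa> * exp (\<delta> * Im z) / 2))"
        using normE[OF \<epsilon>] that by (auto simp: Q_def in_cbox_complex_iff)
      also have "\<dots> \<le> 1" using \<epsilon> \<kappa> by simp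
      finally show ?thesis .
    qed
    have hol: "(\<lambda>z. f z * E \<epsilon> z) holomorphic_on {s. Im s > M}"
      unfolding E_def by (intro holomorphic_intros f)
    show ?thesis
    proof (rule maximum_modulus_frontier[of "\<lambda>z. f z * E \<epsilon> z" Q])
      show "(\<lambda>z. f z * E \<epsilon> z) holomorphic_on interior Q"
        using hol QM interior_subset by (meson holomorphic_on_subset order_trans)
      show "continuous_on (closure Q) (\<lambda>z. f z * E \<epsilon> z)"
        using holomorphic_on_imp_continuous_on[OF hol] QM by (simp add: Q_def) (meson continuous_on_subset)
      show "bounded Q" by (simp add: Q_def)
      show "s \<in> Q" using s R by (auto simp: Q_def in_cbox_complex_iff)
      show "norm (f z * E \<epsilon> z) \<le> K" if z: "z \<in> frontier Q" for z
      proof -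
        have zQ: "z \<in> Q" using z by (simp add: Q_def frontier_cbox)
        have zz: "\<sigma>' \<le> Re z" "Re z \<le> \<sigma>" "M' \<le> Im z" "Im z \<le> R"
          using zQ by (auto simp: Q_def in_cbox_complex_iff)
        have "z \<notin> box (Complex \<sigma>' M') (Complex \<sigma> R)" using z by (simp add: Q_def frontier_cbox)
        then consider "Re z = \<sigma>'" | "Re z = \<sigma>" | "Im z = M'" | "Im z = R"
          using zz by (force simp: in_box_complex_iff)
        then have "norm (f z) \<le> K \<or> Im z = R"
        proof cases
          case 1
          then show ?thesis using edge(2)[of "Im z"] zz K by (metis complex.collapse order_trans)
        next
          case 2
          then show ?thesis using edge(1)[of "Im z"] zz K by (metis complex.collapse order_trans)
        next
          case 3
          then show ?thesis using B0[of z] zz K by (force simp: in_cbox_complex_iff)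
        qed simp
        then show ?thesis
        proof
          assume "norm (f z) \<le> K"
          then have "norm (f z) * norm (E \<epsilon> z) \<le> K * 1"
            using E1[OF zQ] K by (intro mult_mono) auto
          then show ?thesis by (simp add: norm_mult)
        next
          assume zR: "Im z = R"
          have "norm z \<le> D + R"
            using cmod_le[of z] zz zR R unfolding D_def by linarith
          then have "norm (f z) \<le> C * exp ((D + R) powr \<rho>)"
            using fin(3)[OF zz(1-3)] fin(1,2)
            by (meson exp_le_cancel_iff less_imp_le mult_left_mono norm_ge_zero order_trans powr_mono2)
          moreover have "norm (E \<epsilon> z) \<le> exp (- \<epsilon> * (\<kappa> * exp (\<delta> * R) / 2))"
            using normE[OF \<epsilon> zz(1,2)] zR by simp
          ultimately have "norm (f z) * norm (E \<epsilon> z) \<le> C * exp ((D + R) powr \<rho>) * exp (- \<epsilon> * (\<kappa> * exp (\<delta> * R) / 2))"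
            using fin(1) by (intro mult_mono) auto
          then show ?thesis using R(2) by (simp add: norm_mult)
        qed
      qed
    qed
  qed
  have "norm (f s) \<le> K" if s: "\<sigma>' \<le> Re s" "Re s \<le> \<sigma>" "Im s \<ge> M'" for s
  \<comment> \<open>For fixed \<open>s\<close> the factor \<open>E \<epsilon> s\<close> tends to 1
    as \<open>\<epsilon>\<close> decreases to 0.\<close>
  proof (rule tendsto_upperbound)
    show "((\<lambda>\<epsilon>. norm (f s * E \<epsilon> s)) \<longlongrightarrow> norm (f s)) (at_right 0)"
      unfolding E_def by (auto intro!: tendsto_eq_intros)
    show "\<forall>\<^sub>F \<epsilon> in at_right 0. norm (f s * E \<epsilon> s) \<le> K"
      using main[OF s] by (auto simp: eventually_at_right_less eventually_at_filter)
  qed auto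
  then show ?thesis by blast
qed

subsection \<open>Ordinary Dirichlet series\<close>

definition dirichlet_series :: "(nat \<Rightarrow> complex) \<Rightarrow> complex \<Rightarrow> complex" where
  "dirichlet_series a s = (\<Sum>n. a (Suc n) * of_nat (Suc n) powr (-s))"

text \<open>Absolute convergence at a point depends only on its real part, hence the real
  argument.\<close>

definition abs_conv_at :: "(nat \<Rightarrow> complex) \<Rightarrow> real \<Rightarrow> bool" where
  "abs_conv_at a \<sigma> \<longleftrightarrow> summable (\<lambda>n. norm (a (Suc n)) * real (Suc n) powr (-\<sigma>))"

lemma norm_Suc_powr: "norm (of_nat (Suc n) powr s :: complex) = real (Suc n) powr Re s"
  using norm_powr_real_powr[of "of_nat (Suc n)" s] by simp

lemma norm_dirichlet_term:
  "norm (a (Suc n) * of_nat (Suc n) powr (-s)) = norm (a (Suc n)) * real (Suc n) powr (- Re s)"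
  by (simp add: norm_mult norm_Suc_powr del: of_nat_Suc)

lemma abs_conv_at_mono: "abs_conv_at a \<sigma> \<Longrightarrow> \<sigma> \<le> \<tau> \<Longrightarrow> abs_conv_at a \<tau>"
  unfolding abs_conv_at_def
  by (erule summable_comparison_test') (auto intro!: mult_left_mono powr_mono simp del: of_nat_Suc)

lemma abs_conv_at_imp_summable:
  "abs_conv_at a (Re s) \<Longrightarrow> summable (\<lambda>n. a (Suc n) * of_nat (Suc n) powr (-s))"
  unfolding abs_conv_at_def norm_dirichlet_term[symmetric] by (rule summable_norm_cancel)

text \<open>Turns a strict inequality for the abscissa, including the value
  \<open>-\<infinity>\<close>, into a point \<open>\<tau>\<close> of absolute convergence strictly
  left of \<open>\<sigma>\<close>. This leaves room for uniform bounds on the line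
  \<open>Re s = \<sigma>\<close>.\<close>

lemma abs_abscissa_less_iff: "abs_abscissa a < ereal \<sigma> \<longleftrightarrow> (\<exists>\<tau><\<sigma>. abs_conv_at a \<tau>)"
  unfolding abs_abscissa_def Inf_less_iff abs_conv_at_def norm_dirichlet_term by force

text \<open>To the right of \<open>\<sigma>\<close> every term is dominated by its norm at
  \<open>\<sigma>\<close>, so the partial sums converge uniformly.\<close>

lemma dirichlet_series_holomorphic:
  assumes "abs_conv_at a \<sigma>"
  shows "dirichlet_series a holomorphic_on {s. Re s > \<sigma>}"
proof (rule holomorphic_uniform_sequence)
  show "open {s. Re s > \<sigma>}" by (rule open_halfspace_Re_gt)
  show "(\<lambda>s. \<Sum>n<k. a (Suc n) * of_nat (Suc n) powr (-s)) holomorphic_on {s. Re s > \<sigma>}" for k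
    by (intro holomorphic_intros)
  have unif: "uniform_limit {s. Re s > \<sigma>} (\<lambda>k s. \<Sum>n<k. a (Suc n) * of_nat (Suc n) powr (-s))
     (dirichlet_series a) sequentially"
    unfolding dirichlet_series_def
  proof (rule Weierstrass_m_test)
    show "summable (\<lambda>n. norm (a (Suc n)) * real (Suc n) powr (-\<sigma>))"
      using assms by (simp add: abs_conv_at_def)
    show "norm (a (Suc n) * of_nat (Suc n) powr (-s)) \<le> norm (a (Suc n)) * real (Suc n) powr (-\<sigma>)"
      if "s \<in> {s. Re s > \<sigma>}" for n s
      using that unfolding norm_dirichlet_term
      by (auto intro!: mult_left_mono powr_mono simp del: of_nat_Suc)
  qed
  show "\<exists>d>0. cball s d \<subseteq> {s. Re s > \<sigma>} \<and>
      uniform_limit (cball s d) (\<lambda>k s. \<Sum>n<k. a (Suc n) * of_nat (Suc n) powr (-s)) (dirichlet_series a) sequentially"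
    if "s \<in> {s. Re s > \<sigma>}" for s
    using open_contains_cball[THEN iffD1, OF open_halfspace_Re_gt[of \<sigma>], rule_format, OF that]
      uniform_limit_on_subset[OF unif] by blast
qed

section \<open>Identity theorem and the half plane of absolute convergence\<close>

lemma right_half_plane_nonempty: "{s. Re s > x} \<noteq> {}"
  using exI[of "\<lambda>s. Re s > x" "of_real (x + 1)"] by simp

text \<open>On a connected open set the meromorphic difference \<open>f - g\<close> vanishes off a
  sparse set or is nonzero off a sparse set, and agreement on \<open>T\<close> excludes the latter.
  So \<open>f\<close> has the limit \<open>g z\<close> at \<open>z\<close>; hence \<open>z\<close>
  is no pole, and niceness makes \<open>f z\<close> equal to this limit.\<close>

lemma nicely_meromorphic_identity:
  assumes f: "f nicely_meromorphic_on UNIV" and g: "g holomorphic_on S"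
    and S: "open S" "connected S" and T: "open T" "T \<noteq> {}" "T \<subseteq> S"
    and eq: "\<And>s. s \<in> T \<Longrightarrow> f s = g s" and "z \<in> S"
  shows "f z = g z"
proof -
  have g': "g analytic_on S" using g S by (simp add: analytic_on_open)
  have "(\<lambda>s. f s - g s) meromorphic_on S"
    using f by (intro meromorphic_on_diff analytic_on_imp_meromorphic_on[OF g'])
      (auto simp: nicely_meromorphic_on_def intro: meromorphic_on_subset)
  then have "(\<forall>\<^sub>\<approx>s\<in>S. f s - g s = 0) \<or> (\<forall>\<^sub>\<approx>s\<in>S. f s - g s \<noteq> 0)"
    by (intro meromorphic_imp_constant_or_avoid S)
  moreover have "\<not> (\<forall>\<^sub>\<approx>s\<in>S. f s - g s \<noteq> 0)"
  proof
    assume *: "\<forall>\<^sub>\<approx>s\<in>S. f s - g s \<noteq> 0"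
    obtain t where t: "t \<in> T" using T by blast
    then have "eventually (\<lambda>s. f s - g s \<noteq> 0) (at t)"
      using * T S by (auto simp: eventually_cosparse_open_eq)
    moreover have "eventually (\<lambda>s. s \<in> T) (at t)"
      using T t by (intro eventually_at_in_open') auto
    ultimately have "eventually (\<lambda>s. False) (at t)"
      by eventually_elim (use eq in auto)
    then show False by simp
  qed
  ultimately have ev: "eventually (\<lambda>s. f s = g s) (at z)"
    using \<open>z \<in> S\<close> S by (auto simp: eventually_cosparse_open_eq)
  have "isCont g z"
    using g' \<open>z \<in> S\<close> analytic_at_imp_isCont analytic_on_analytic_at by blast
  then have lim: "f \<midarrow>z\<rightarrow> g z"
    using tendsto_cong[OF ev] by (simp add: isCont_def)
  then have "\<not> is_pole f z"
    unfolding is_pole_def using not_tendsto_and_filterlim_at_infinity[of "at z" f] by auto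
  then have "f \<midarrow>z\<rightarrow> f z"
    using f by (auto simp: nicely_meromorphic_on_def)
  then show ?thesis using lim LIM_unique by blast
qed

context
  fixes f a
  assumes rep: "represented_by_ODS f a"
begin

text \<open>The definition gives the series only for large real part; the identity theorem extends
  the equation to the whole half plane of absolute convergence.\<close>

lemma ODS_eq_dirichlet_series:
  assumes "abs_conv_at a \<sigma>" "Re s > \<sigma>"
  shows "f s = dirichlet_series a s"
proof -
  obtain \<tau> where \<tau>: "\<And>s. Re s > \<tau> \<Longrightarrow> (\<lambda>n. a (Suc n) * of_nat (Suc n) powr (-s)) sums f s"
    using rep unfolding represented_by_ODS_def by blast
  show ?thesis
  proof (rule nicely_meromorphic_identity[OF _ dirichlet_series_holomorphic[OF assms(1)]])
    show "f nicely_meromorphic_on UNIV" using rep by (simp add: represented_by_ODS_def)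
    show "open {s. Re s > \<sigma>}" "open {s. Re s > max \<sigma> \<tau>}" by (rule open_halfspace_Re_gt)+
    show "connected {s. Re s > \<sigma>}" by (intro convex_connected convex_halfspace_Re_gt)
    show "{s. Re s > max \<sigma> \<tau>} \<noteq> {}" by (rule right_half_plane_nonempty)
    show "f s = dirichlet_series a s" if "s \<in> {s. Re s > max \<sigma> \<tau>}" for s
      using \<tau>[of s] that by (simp add: dirichlet_series_def sums_iff)
  qed (use assms in auto)
qed

lemma ODS_analytic_at:
  assumes "abs_conv_at a \<sigma>" "Re s > \<sigma>"
  shows "f analytic_on {s}"
proof -
  have "f holomorphic_on {s. Re s > \<sigma>}"
    by (rule holomorphic_transform[OF dirichlet_series_holomorphic[OF assms(1)]])
      (simp add: ODS_eq_dirichlet_series[OF assms(1)])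
  then show ?thesis
    using assms(2) by (auto simp: analytic_at intro!: open_halfspace_Re_gt)
qed

text \<open>The bound is uniform in the half plane and supplies the bounds on the edges of a
  strip.\<close>

lemma ODS_norm_le:
  assumes "abs_conv_at a \<sigma>" "Re s > \<sigma>"
  shows "norm (f s) \<le> (\<Sum>n. norm (a (Suc n)) * real (Suc n) powr (-\<sigma>))"
proof -
  have *: "norm (a (Suc n) * of_nat (Suc n) powr (-s)) \<le> norm (a (Suc n)) * real (Suc n) powr (-\<sigma>)" for n
    using assms(2) unfolding norm_dirichlet_term
    by (auto intro!: mult_left_mono powr_mono simp del: of_nat_Suc)
  have "summable (\<lambda>n. norm (a (Suc n) * of_nat (Suc n) powr (-s)))"
    using abs_conv_at_mono[OF assms(1), of "Re s"] assms(2)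
    unfolding norm_dirichlet_term abs_conv_at_def by simp
  then show ?thesis
    unfolding ODS_eq_dirichlet_series[OF assms] dirichlet_series_def
    using assms(1) * by (intro order_trans[OF summable_norm] suminf_le) (auto simp: abs_conv_at_def)
qed

text \<open>Where the series converges its terms are bounded, and moving two units to the right
  gains the summable factor \<open>real (Suc n) powr (-2)\<close>. The value
  \<open>-\<infinity>\<close> remains possible.\<close>

lemma ODS_abscissa_finite: "abs_abscissa a \<noteq> \<infinity>"
proof -
  obtain \<tau> where \<tau>: "\<And>s. Re s > \<tau> \<Longrightarrow> (\<lambda>n. a (Suc n) * of_nat (Suc n) powr (-s)) sums f s"
    using rep unfolding represented_by_ODS_def by blast
  define x where "x = \<tau> + 1"
  have "(\<lambda>n. a (Suc n) * of_nat (Suc n) powr (- of_real x)) \<longlonglongrightarrow> 0"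
    using \<tau>[of "of_real x"] by (auto simp: x_def intro!: summable_LIMSEQ_zero sums_summable)
  then have "Bseq (\<lambda>n. a (Suc n) * of_nat (Suc n) powr (- of_real x))"
    using convergent_imp_Bseq convergentI by blast
  then obtain K where K: "\<And>n. norm (a (Suc n) * of_nat (Suc n) powr (- of_real x)) \<le> K"
    unfolding Bseq_def by blast
  have le: "norm (norm (a (Suc n)) * real (Suc n) powr (-(x + 2))) \<le> K * real (Suc n) powr (-2)" for n
  proof -
    have "norm (norm (a (Suc n)) * real (Suc n) powr (-(x + 2))) = (norm (a (Suc n)) * real (Suc n) powr (-x)) * real (Suc n) powr (-2)"
      by (simp add: powr_add[symmetric] del: of_nat_Suc)
    also have "\<dots> \<le> K * real (Suc n) powr (-2)"
      using K[of n] unfolding norm_dirichlet_term by (intro mult_right_mono) auto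
    finally show ?thesis .
  qed
  have sm: "summable (\<lambda>n. real (Suc n) powr (-2))"
    using summable_real_powr_iff[of "-2"] by (subst summable_Suc_iff) simp
  have "abs_conv_at a (x + 2)"
    unfolding abs_conv_at_def by (rule summable_comparison_test'[OF summable_mult[OF sm] le])
  then have "abs_abscissa a < ereal (x + 3)"
    by (subst abs_abscissa_less_iff) (auto intro!: exI[of _ "x + 2"])
  then show ?thesis by auto
qed

end

text \<open>Only finitely many \<open>\<bar>\<mu> n\<bar>\<close> lie below 1, so the nonzero ones
  among them have a positive minimum.\<close>

lemma discrete_away_from_zero:
  fixes \<mu> :: "nat \<Rightarrow> real"
  assumes "filterlim (\<lambda>n. \<bar>\<mu> n\<bar>) at_top sequentially"
  obtains \<delta> where "\<delta> > 0" "\<And>n. \<mu> n \<noteq> 0 \<Longrightarrow> \<delta> \<le> \<bar>\<mu> n\<bar>"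
proof -
  obtain n0 where n0: "\<And>n. n \<ge> n0 \<Longrightarrow> 1 \<le> \<bar>\<mu> n\<bar>"
    using filterlim_at_top[THEN iffD1, OF assms, rule_format, of 1] by (auto simp: eventually_sequentially)
  \<comment> \<open>The inserted 1 covers the tail and keeps the minimum defined when the finite set
    is empty.\<close>
  define \<delta> where "\<delta> = Min (insert 1 ((\<lambda>n. \<bar>\<mu> n\<bar>) ` {n. n < n0 \<and> \<mu> n \<noteq> 0}))"
  show ?thesis
  proof (rule that)
    show "\<delta> > 0" by (auto simp: \<delta>_def)
    show "\<delta> \<le> \<bar>\<mu> n\<bar>" if "\<mu> n \<noteq> 0" for n
    proof (cases "n < n0")
      case True
      then show ?thesis using that by (auto simp: \<delta>_def intro!: Min_le)
    next
      case False
      have "\<delta> \<le> 1" by (auto simp: \<delta>_def intro!: Min_le)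
      then show ?thesis using n0[of n] False by simp
    qed
  qed
qed

lemma of_real_powr_eq_exp: "x > 0 \<Longrightarrow> complex_of_real x powr s = exp (s * of_real (ln x))"
  by (simp add: powr_def Ln_of_real)

lemma exp_Complex_times_real: "exp (Complex \<sigma> t * of_real \<mu>) = of_real (exp (\<sigma> * \<mu>)) * cis (\<mu> * t)"
  by (simp add: Complex_eq cis_conv_exp exp_of_real[symmetric] exp_add[symmetric] algebra_simps)

subsection \<open>The functional equation and the coefficients\<close>

locale ODS_functional_equation =
  fixes N :: real and f g :: "complex \<Rightarrow> complex" and a b :: "nat \<Rightarrow> complex"
  assumes N: "N > 0"
    and f: "represented_by_ODS f a" and g: "represented_by_ODS g b"
    and feq: "\<And>s. f (-s) = of_real N powr s * g s"
begin

lemma feq': "f s = of_real N powr (-s) * g (-s)"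
  using feq[of "-s"] by simp

text \<open>The functional equation carries the half plane of absolute convergence of
  \<open>b\<close> over to the left by \<open>s \<mapsto> -s\<close>.\<close>

lemma left_analytic_at:
  assumes "abs_conv_at b \<tau>" "Re s < -\<tau>"
  shows "f analytic_on {s}"
proof -
  have "g analytic_on {s. Re s > \<tau>}"
    using ODS_analytic_at[OF g assms(1)] by (subst analytic_on_analytic_at) auto
  then have "(g \<circ> uminus) holomorphic_on {s. Re s < -\<tau>}"
    by (intro holomorphic_on_compose_gen[OF _ analytic_imp_holomorphic] holomorphic_intros) auto
  then have "(\<lambda>s. of_real N powr (-s) * (g \<circ> uminus) s) holomorphic_on {s. Re s < -\<tau>}"
    by (intro holomorphic_intros)
  then have "f holomorphic_on {s. Re s < -\<tau>}"
    by (rule holomorphic_transform) (simp add: feq'[symmetric])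
  then show ?thesis
    using assms(2) by (auto simp: analytic_at intro!: open_halfspace_Re_lt)
qed

lemma norm_left: "norm (f s) = N powr (- Re s) * norm (g (-s))"
  using N by (simp add: feq' norm_mult norm_powr_real_powr)

text \<open>The data required by \<open>mean_value_transfer\<close>: the right edge lies where the
  series of \<open>a\<close> converges absolutely, the left edge where the reflected series of
  \<open>b\<close> does. Allowing \<open>\<sigma>' = \<sigma>\<close> admits a strip that is a
  single line.\<close>

definition admissible_strip :: "real \<Rightarrow> real \<Rightarrow> real \<Rightarrow> real \<Rightarrow> bool" where
  "admissible_strip M \<sigma>' \<sigma> K \<longleftrightarrow> \<sigma>' \<le> \<sigma> \<and> abs_abscissa a < ereal \<sigma> \<and> abs_abscissa b < ereal (-\<sigma>') \<and>
     f holomorphic_on {s. Im s > M} \<and>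
     (\<forall>s. \<sigma>' \<le> Re s \<longrightarrow> Re s \<le> \<sigma> \<longrightarrow> Im s > M \<longrightarrow> norm (f s) \<le> K)"

text \<open>The case of an empty order region (an abscissa \<open>-\<infinity>\<close>, or overlapping half planes of absolute
  convergence): both series then converge absolutely on a common line, and condition (3) is vacuous.\<close>

lemma admissible_common_line:
  assumes "abs_abscissa a < ereal \<sigma>" "abs_abscissa b < ereal (-\<sigma>)"
  shows "\<exists>K. admissible_strip 0 \<sigma> \<sigma> K"
proof -
  obtain \<tau> \<tau>' where \<tau>: "\<tau> < \<sigma>" "abs_conv_at a \<tau>" and \<tau>': "\<tau>' < -\<sigma>" "abs_conv_at b \<tau>'"
    using assms unfolding abs_abscissa_less_iff by blast
  \<comment> \<open>Since \<open>\<tau> < \<sigma> < -\<tau>'\<close>, the two half planes of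
    analyticity cover the plane.\<close>
  have "f analytic_on {s}" for s
    using ODS_analytic_at[OF f \<tau>(2), of s] left_analytic_at[OF \<tau>'(2), of s] \<tau> \<tau>' by linarith
  then have "f analytic_on UNIV" using analytic_on_analytic_at by blast
  then have "f holomorphic_on {s. Im s > 0}"
    using analytic_imp_holomorphic holomorphic_on_subset by blast
  moreover have "norm (f s) \<le> (\<Sum>n. norm (a (Suc n)) * real (Suc n) powr (-\<tau>))"
    if "\<sigma> \<le> Re s" for s
    using ODS_norm_le[OF f \<tau>(2), of s] \<tau> that by simp
  ultimately show ?thesis
    unfolding admissible_strip_def using assms by blast
qed

text \<open>Finite order excludes poles between the half planes of convergence, and on the two edges
  the series are bounded; Phragmen-Lindelof then bounds \<open>f\<close> in between. The edges are
  those of the order region, one unit inside each half plane of absolute convergence.\<close>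

lemma finite_order_strip:
  assumes fin: "finite_order_on f (order_region (ereal \<alpha>) (ereal \<beta>) M)" and "M > 0"
    and \<alpha>: "abs_abscissa a = ereal \<alpha>" and \<beta>: "abs_abscissa b = ereal \<beta>" and le: "-\<beta> \<le> \<alpha>"
  shows "\<exists>K. admissible_strip (M + 1) (-1 - \<beta>) (\<alpha> + 1) K"
proof -
  define \<sigma> \<sigma>' where "\<sigma> = \<alpha> + 1" and "\<sigma>' = -1 - \<beta>"
  obtain \<rho> C where \<rho>: "\<rho> > 0" and C: "C > 0"
    and bound: "\<And>s. \<sigma>' \<le> Re s \<Longrightarrow> Re s \<le> \<sigma> \<Longrightarrow> \<bar>Im s\<bar> \<ge> M \<Longrightarrow> norm (f s) \<le> C * exp (norm s powr \<rho>)"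
    using fin unfolding finite_order_on_def order_region_def \<sigma>_def \<sigma>'_def
    by (auto simp: one_ereal_def)
  have sless: "abs_abscissa a < ereal \<sigma>" "abs_abscissa b < ereal (-\<sigma>')"
    by (simp_all add: \<alpha> \<beta> \<sigma>_def \<sigma>'_def)
  have ord: "\<sigma>' < \<sigma>" using le by (simp add: \<sigma>_def \<sigma>'_def)
  obtain \<tau> \<tau>' where \<tau>: "\<tau> < \<sigma>" "abs_conv_at a \<tau>" and \<tau>': "\<tau>' < -\<sigma>'" "abs_conv_at b \<tau>'"
    using sless unfolding abs_abscissa_less_iff by blast
  have an: "f analytic_on {s}" if s: "Im s > M" for s
  proof -
    \<comment> \<open>The first two cases include the edges, so the third concerns interior points,
      which have a full neighbourhood in the order region.\<close>
    consider "Re s > \<tau>" | "Re s < -\<tau>'" | "\<sigma>' < Re s" "Re s < \<sigma>"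
      using \<tau> \<tau>' ord by linarith
    then show ?thesis
    proof cases
      case 3
      \<comment> \<open>The ball keeps \<open>norm z\<close> below \<open>norm s + 1\<close>, which
        turns the growth bound into a constant bound near \<open>s\<close> and rules out a
        pole.\<close>
      define V where "V = {z. \<sigma>' < Re z} \<inter> {z. Re z < \<sigma>} \<inter> {z. Im z > M} \<inter> ball 0 (norm s + 1)"
      have V: "open V" "s \<in> V"
        using 3 s by (auto simp: V_def intro!: open_Int open_halfspace_Re_gt open_halfspace_Re_lt open_halfspace_Im_gt)
      define K where "K = C * exp ((norm s + 1) powr \<rho>)"
      have K: "norm (f z) \<le> K" if "z \<in> V" for z
      proof -
        have "norm (f z) \<le> C * exp (norm z powr \<rho>)"
          using that \<open>M > 0\<close> by (intro bound) (auto simp: V_def)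
        also have "\<dots> \<le> K"
          unfolding K_def using that C \<rho> by (intro mult_left_mono) (auto simp: V_def intro!: powr_mono2)
        finally show ?thesis .
      qed
      have "\<not> is_pole f s"
      proof
        assume "is_pole f s"
        then have "eventually (\<lambda>z. K + 1 \<le> norm (f z)) (at s)"
          unfolding is_pole_def filterlim_at_infinity_conv_norm_at_top filterlim_at_top by blast
        moreover have "eventually (\<lambda>z. z \<in> V) (at s)"
          using V by (intro eventually_at_in_open') auto
        ultimately have "eventually (\<lambda>z. False) (at s)"
          by eventually_elim (use K in force)
        then show False by simp
      qed
      then show ?thesis
        using f nicely_meromorphic_on_imp_analytic_at[of f UNIV s] by (simp add: represented_by_ODS_def)
    qed (use ODS_analytic_at[OF f \<tau>(2)] left_analytic_at[OF \<tau>'(2)] in auto)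
  qed
  have "f analytic_on {s. Im s > M}"
    using an by (subst analytic_on_analytic_at) auto
  then have hol: "f holomorphic_on {s. Im s > M}" by (rule analytic_imp_holomorphic)
  define B1 where "B1 = (\<Sum>n. norm (a (Suc n)) * real (Suc n) powr (-\<tau>))"
  \<comment> \<open>The power of \<open>N\<close> comes from the functional equation on the left
    edge.\<close>
  define B2 where "B2 = N powr (-\<sigma>') * (\<Sum>n. norm (b (Suc n)) * real (Suc n) powr (-\<tau>'))"
  have "\<exists>K. \<forall>s. \<sigma>' \<le> Re s \<longrightarrow> Re s \<le> \<sigma> \<longrightarrow> Im s \<ge> M + 1 \<longrightarrow> norm (f s) \<le> K"
  proof (rule Phragmen_Lindelof_half_strip[OF hol _ ord])
    show "norm (f (Complex \<sigma> t)) \<le> max B1 B2" for t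
      using ODS_norm_le[OF f \<tau>(2), of "Complex \<sigma> t"] \<tau>(1) by (simp add: B1_def)
    show "norm (f (Complex \<sigma>' t)) \<le> max B1 B2" for t
    proof -
      have "norm (f (Complex \<sigma>' t)) \<le> B2"
        unfolding norm_left B2_def
        using ODS_norm_le[OF g \<tau>'(2), of "- Complex \<sigma>' t"] \<tau>'(1) by (simp add: mult_left_mono)
      then show ?thesis by simp
    qed
    show "norm (f s) \<le> C * exp (norm s powr \<rho>)" if "\<sigma>' \<le> Re s" "Re s \<le> \<sigma>" "Im s \<ge> M + 1" for s
      using that \<open>M > 0\<close> by (intro bound) auto
  qed (use C \<rho> in auto)
  then obtain K where K: "\<And>s. \<sigma>' \<le> Re s \<Longrightarrow> Re s \<le> \<sigma> \<Longrightarrow> Im s \<ge> M + 1 \<Longrightarrow> norm (f s) \<le> K" by blast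
  have "admissible_strip (M + 1) \<sigma>' \<sigma> K"
    unfolding admissible_strip_def
    using sless ord K by (auto intro: holomorphic_on_subset[OF hol])
  then show ?thesis unfolding \<sigma>_def \<sigma>'_def by blast
qed

text \<open>Either some line lies in both half planes of absolute convergence, or both abscissas are
  real with \<open>-\<beta> \<le> \<alpha>\<close> and the order region is a genuine pair of half
  strips.\<close>

lemma admissible_strip_exists:
  assumes "M > 0" "finite_order_on f (order_region (abs_abscissa a) (abs_abscissa b) M)"
  shows "\<exists>M' \<sigma>' \<sigma> K. admissible_strip M' \<sigma>' \<sigma> K"
proof (cases "\<exists>\<sigma>. abs_abscissa a < ereal \<sigma> \<and> abs_abscissa b < ereal (-\<sigma>)")
  case True
  then show ?thesis using admissible_common_line by blast
next
  case False
  obtain x y where x: "abs_abscissa a < ereal x" and y: "abs_abscissa b < ereal y"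
    using ODS_abscissa_finite[OF f] ODS_abscissa_finite[OF g]
    by (metis ereal_dense2 less_PInf_Ex_of_nat ereal_infty_less(1))
  \<comment> \<open>If an abscissa were \<open>-\<infinity>\<close>, any line in the half plane of
    the other series would be a common line.\<close>
  have "abs_abscissa a \<noteq> -\<infinity>" "abs_abscissa b \<noteq> -\<infinity>"
    using False x y by (auto dest: spec[of _ x] spec[of _ "-y"])
  then obtain \<alpha> \<beta> where \<alpha>\<beta>: "abs_abscissa a = ereal \<alpha>" "abs_abscissa b = ereal \<beta>"
    using ODS_abscissa_finite[OF f] ODS_abscissa_finite[OF g] ereal_cases by metis
  have "-\<beta> \<le> \<alpha>"
  proof (rule ccontr)
    assume "\<not> -\<beta> \<le> \<alpha>"
    \<comment> \<open>The midpoint of \<open>\<alpha>\<close> and \<open>-\<beta>\<close> would give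
      a common line.\<close>
    then have "abs_abscissa a < ereal ((\<alpha> - \<beta>) / 2) \<and> abs_abscissa b < ereal (-((\<alpha> - \<beta>) / 2))"
      by (simp add: \<alpha>\<beta> field_simps)
    then show False using False by blast
  qed
  with finite_order_strip[of \<alpha> \<beta> M] assms \<alpha>\<beta> show ?thesis by auto
qed

text \<open>Multiplying \<open>f\<close> by \<open>k powr s\<close> moves the \<open>k\<close>-th
  coefficient to frequency 0 on the right line; on the left line frequency 0 means
  \<open>m * k = N\<close>. Transfer of mean values equates the two. At most one term of the sum is
  nonzero.\<close>

lemma coefficients_eq:
  assumes "M > 0" "finite_order_on f (order_region (abs_abscissa a) (abs_abscissa b) M)" and "k > 0"
  shows "a k = (\<Sum>n. if real (Suc n * k) = N then b (Suc n) else 0)"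
proof -
  obtain M' \<sigma>' \<sigma> K where ord: "\<sigma>' \<le> \<sigma>" and ab: "abs_abscissa a < ereal \<sigma>" "abs_abscissa b < ereal (-\<sigma>')"
    and hol: "f holomorphic_on {s. Im s > M'}"
    and K: "\<And>s. \<sigma>' \<le> Re s \<Longrightarrow> Re s \<le> \<sigma> \<Longrightarrow> Im s > M' \<Longrightarrow> norm (f s) \<le> K"
    using admissible_strip_exists[OF assms(1,2)] unfolding admissible_strip_def by blast
  obtain \<tau> \<tau>' where \<tau>: "\<tau> < \<sigma>" "abs_conv_at a \<tau>" and \<tau>': "\<tau>' < -\<sigma>'" "abs_conv_at b \<tau>'"
    using ab unfolding abs_abscissa_less_iff by blast
  define h where "h s = f s * of_real (real k) powr s" for s
  \<comment> \<open>The frequencies are the logarithms of \<open>k / (n + 1)\<close> on the right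
    and of \<open>(n + 1) * k / N\<close> on the left; the amplitudes \<open>c\<close> and
    \<open>d\<close> absorb the moduli on the two lines.\<close>
  define \<mu> where "\<mu> n = ln (real k) - ln (real (Suc n))" for n
  define \<nu> where "\<nu> n = ln (real (Suc n)) - (ln N - ln (real k))" for n
  define c where "c n = a (Suc n) * of_real (exp (\<sigma> * \<mu> n))" for n
  define d where "d n = b (Suc n) * of_real (exp (\<sigma>' * \<nu> n))" for n
  have k: "real k > 0" using \<open>k > 0\<close> by simp
  \<comment> \<open>Divergence of the logarithms yields the gap around 0 between the
    frequencies.\<close>
  have lim: "filterlim (\<lambda>n. \<bar>\<mu> n\<bar>) at_top sequentially" "filterlim (\<lambda>n. \<bar>\<nu> n\<bar>) at_top sequentially"
    unfolding \<mu>_def \<nu>_def by real_asymp+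
  obtain \<delta> where \<delta>: "\<delta> > 0" "\<And>n. \<mu> n \<noteq> 0 \<Longrightarrow> \<delta> \<le> \<bar>\<mu> n\<bar>"
    using discrete_away_from_zero[OF lim(1)] by blast
  obtain \<delta>' where \<delta>': "\<delta>' > 0" "\<And>n. \<nu> n \<noteq> 0 \<Longrightarrow> \<delta>' \<le> \<bar>\<nu> n\<bar>"
    using discrete_away_from_zero[OF lim(2)] by blast
  have c: "summable (\<lambda>n. norm (c n))"
  proof -
    have "norm (c n) = k powr \<sigma> * (norm (a (Suc n)) * real (Suc n) powr (-\<sigma>))" for n
    proof -
      have "exp (\<sigma> * \<mu> n) = k powr \<sigma> * real (Suc n) powr (-\<sigma>)"
        using k by (simp add: \<mu>_def powr_def algebra_simps exp_diff exp_minus divide_inverse del: of_nat_Suc)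
      then show ?thesis
        unfolding c_def norm_mult norm_of_real by simp
    qed
    then show ?thesis
      using abs_conv_at_mono[OF \<tau>(2), of \<sigma>] \<tau>(1) by (simp add: abs_conv_at_def summable_mult del: of_nat_Suc)
  qed
  have d: "summable (\<lambda>n. norm (d n))"
  proof -
    have "norm (d n) = exp (\<sigma>' * (ln k - ln N)) * (norm (b (Suc n)) * real (Suc n) powr (-(-\<sigma>')))" for n
    proof -
      have "exp (\<sigma>' * \<nu> n) = exp (\<sigma>' * (ln k - ln N)) * real (Suc n) powr (-(-\<sigma>'))"
        using k N by (simp add: \<nu>_def powr_def algebra_simps exp_diff exp_add divide_inverse del: of_nat_Suc)
      then show ?thesis
        unfolding d_def norm_mult norm_of_real by simp
    qed
    then show ?thesis
      using abs_conv_at_mono[OF \<tau>'(2), of "-\<sigma>'"] \<tau>'(1) by (simp add: abs_conv_at_def summable_mult del: of_nat_Suc)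
  qed
  have term_a: "a (Suc n) * of_nat (Suc n) powr (-s) * of_real (real k) powr s
      = c n * cis (\<mu> n * t)" if "s = Complex \<sigma> t" for n s t
  proof -
    have "of_nat (Suc n) powr (-s) * of_real (real k) powr s = exp (s * of_real (\<mu> n))"
      using k of_real_powr_eq_exp[of "real (Suc n)" "-s"] of_real_powr_eq_exp[of "real k" s]
      by (simp add: \<mu>_def exp_add[symmetric] algebra_simps del: of_nat_Suc)
    then show ?thesis by (simp add: that exp_Complex_times_real c_def mult.assoc)
  qed
  have term_b: "of_real N powr (-s) * (b (Suc n) * of_nat (Suc n) powr (-(-s))) * of_real (real k) powr s
      = d n * cis (\<nu> n * t)" if "s = Complex \<sigma>' t" for n s t
  proof -
    have "of_real N powr (-s) * of_nat (Suc n) powr s * of_real (real k) powr s = exp (s * of_real (\<nu> n))"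
      using k N of_real_powr_eq_exp[of "real (Suc n)" "s"] of_real_powr_eq_exp[of "real k" s]
        of_real_powr_eq_exp[of N "-s"]
      by (simp add: \<nu>_def exp_add[symmetric] algebra_simps del: of_nat_Suc)
    then show ?thesis by (simp add: that exp_Complex_times_real d_def mult_ac)
  qed
  have sum_a: "summable (\<lambda>n. a (Suc n) * of_nat (Suc n) powr (-s))" if "Re s = \<sigma>" for s
    using abs_conv_at_mono[OF \<tau>(2), of \<sigma>] \<tau>(1) that by (intro abs_conv_at_imp_summable) simp
  have sum_b: "summable (\<lambda>n. b (Suc n) * of_nat (Suc n) powr (-s))" if "Re s = -\<sigma>'" for s
    using abs_conv_at_mono[OF \<tau>'(2), of "-\<sigma>'"] \<tau>'(1) that by (intro abs_conv_at_imp_summable) simp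
  have "(\<Sum>n. if \<mu> n = 0 then c n else 0) = (\<Sum>n. if \<nu> n = 0 then d n else 0)"
  proof (rule mean_value_transfer[OF _ _ ord c \<delta> d \<delta>'])
    show "h holomorphic_on {s. Im s > M'}"
      unfolding h_def by (intro holomorphic_intros hol)
    show "norm (h s) \<le> K * k powr \<sigma>" if "\<sigma>' \<le> Re s" "Re s \<le> \<sigma>" "Im s > M'" for s
    proof -
      have "norm (of_real (real k) powr s) \<le> k powr \<sigma>"
        using k that \<open>k > 0\<close> by (subst norm_powr_real_powr) (auto intro!: powr_mono)
      then show ?thesis
        unfolding h_def norm_mult
        by (intro mult_mono K[OF that] order_trans[OF norm_ge_zero K[OF that]]) auto
    qed
    show "h (Complex \<sigma> t) = (\<Sum>n. c n * cis (\<mu> n * t))" for t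
    proof -
      have "h (Complex \<sigma> t) = dirichlet_series a (Complex \<sigma> t) * of_real (real k) powr Complex \<sigma> t"
        unfolding h_def using ODS_eq_dirichlet_series[OF f \<tau>(2)] \<tau>(1) by simp
      also have "\<dots> = (\<Sum>n. c n * cis (\<mu> n * t))"
        unfolding dirichlet_series_def by (subst suminf_mult2) (simp_all only: sum_a complex.sel term_a[OF refl])
      finally show ?thesis .
    qed
    show "h (Complex \<sigma>' t) = (\<Sum>n. d n * cis (\<nu> n * t))" for t
    proof -
      define s where "s = Complex \<sigma>' t"
      have sb: "summable (\<lambda>n. b (Suc n) * of_nat (Suc n) powr (-(-s)))"
        by (rule sum_b) (simp add: s_def)
      have "h s = of_real N powr (-s) * dirichlet_series b (-s) * of_real (real k) powr s"
        unfolding h_def feq' using ODS_eq_dirichlet_series[OF g \<tau>'(2), of "-s"] \<tau>'(1) by (simp add: s_def)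
      also have "\<dots> = (\<Sum>n. of_real N powr (-s) * (b (Suc n) * of_nat (Suc n) powr (-(-s))) * of_real (real k) powr s)"
        unfolding dirichlet_series_def using suminf_mult[OF sb] suminf_mult2[OF summable_mult[OF sb]] by simp
      also have "\<dots> = (\<Sum>n. d n * cis (\<nu> n * t))"
        by (intro suminf_cong term_b s_def)
      finally show ?thesis by (simp add: s_def)
    qed
  qed
  \<comment> \<open>The coefficient \<open>a k\<close> sits at index \<open>k - 1\<close>; at
    frequency 0 the weight \<open>exp (\<sigma> * \<mu> n)\<close> is 1.\<close>
  also have "(\<lambda>n. if \<mu> n = 0 then c n else 0) = (\<lambda>n. if n = k - 1 then a k else 0)"
  proof
    fix n
    have "\<mu> n = 0 \<longleftrightarrow> k = Suc n"
      using k by (simp add: \<mu>_def del: of_nat_Suc)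
    then show "(if \<mu> n = 0 then c n else 0) = (if n = k - 1 then a k else 0)"
      using \<open>k > 0\<close> by (auto simp: c_def)
  qed
  also have "(\<Sum>n. if n = k - 1 then a k else 0) = a k"
    using sums_single[of "k - 1" "\<lambda>_. a k"] by (simp add: sums_iff)
  also have "(\<lambda>n. if \<nu> n = 0 then d n else 0) = (\<lambda>n. if real (Suc n * k) = N then b (Suc n) else 0)"
  proof
    fix n
    have "\<nu> n = ln (real (Suc n * k)) - ln N"
      using k N ln_mult[of "real (Suc n)" "real k"] unfolding \<nu>_def of_nat_mult by (simp del: of_nat_Suc)
    moreover have "real (Suc n * k) > 0" unfolding of_nat_0_less_iff using \<open>k > 0\<close> by simp
    ultimately have "\<nu> n = 0 \<longleftrightarrow> real (Suc n * k) = N"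
      using N by (metis eq_iff_diff_eq_0 ln_inj_iff)
    then show "(if \<nu> n = 0 then d n else 0) = (if real (Suc n * k) = N then b (Suc n) else 0)"
      by (auto simp: d_def)
  qed
  finally show ?thesis .
qed

lemma coefficient_nonzero_imp:
  assumes "M > 0" "finite_order_on f (order_region (abs_abscissa a) (abs_abscissa b) M)" "k > 0" "a k \<noteq> 0"
  shows "\<exists>m. N = real m \<and> k dvd m"
proof (rule ccontr)
  assume "\<not> ?thesis"
  then have "(\<lambda>n. if real (Suc n * k) = N then b (Suc n) else 0) = (\<lambda>_. 0)"
    by (metis dvd_triv_right)
  then show False using coefficients_eq[OF assms(1-3)] assms(4) by simp
qed

end

subsection \<open>Divisor sums\<close>

lemma represented_by_ODS_divisor_sum:
  assumes "n > 0"
  shows "represented_by_ODS (\<lambda>s. \<Sum>u | u dvd n. a u * of_nat u powr (-s)) (\<lambda>k. if k dvd n then a k else 0)"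
proof -
  have fin: "finite {u. u dvd n}" using assms by simp
  have pos: "u > 0" if "u dvd n" for u using that assms by (auto intro: Nat.gr0I)
  have "(\<lambda>s. \<Sum>u | u dvd n. a u * of_nat u powr (-s)) holomorphic_on UNIV"
    by (intro holomorphic_intros) 
  then have "(\<lambda>s. \<Sum>u | u dvd n. a u * of_nat u powr (-s)) nicely_meromorphic_on UNIV"
    by (intro analytic_on_imp_nicely_meromorphic_on) (simp add: analytic_on_open)
  moreover have "(\<lambda>k. (if Suc k dvd n then a (Suc k) else 0) * of_nat (Suc k) powr (-s)) sums
      (\<Sum>u | u dvd n. a u * of_nat u powr (-s))" for s
  proof -
    have "(\<lambda>k. (if Suc k dvd n then a (Suc k) else 0) * of_nat (Suc k) powr (-s)) sums
        (\<Sum>k | Suc k dvd n. (if Suc k dvd n then a (Suc k) else 0) * of_nat (Suc k) powr (-s))"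
    proof (rule sums_finite)
      show "finite {k. Suc k dvd n}"
        using finite_vimageI[OF fin, of Suc] by (simp add: vimage_def)
    qed auto
    also have "(\<Sum>k | Suc k dvd n. (if Suc k dvd n then a (Suc k) else 0) * of_nat (Suc k) powr (-s))
        = (\<Sum>u | u dvd n. a u * of_nat u powr (-s))"
      using pos by (intro sum.reindex_bij_witness[of _ "\<lambda>u. u - 1" Suc]) auto
    finally show ?thesis .
  qed
  ultimately show ?thesis by (auto simp: represented_by_ODS_def)
qed

text \<open>A finite sum converges absolutely everywhere. For such coefficients the order region is
  therefore empty and condition (3) holds trivially.\<close>

lemma abs_abscissa_finite_support:
  assumes "n > 0"
  shows "abs_abscissa (\<lambda>k. if k dvd n then a k else 0) = -\<infinity>"
proof -
  have "abs_conv_at (\<lambda>k. if k dvd n then a k else 0) \<sigma>" for \<sigma>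
    unfolding abs_conv_at_def
  proof (rule summable_finite)
    show "finite {k. Suc k dvd n}"
      using finite_vimageI[of "{u. u dvd n}" Suc] assms by (simp add: vimage_def)
  qed auto
  then have "abs_abscissa (\<lambda>k. if k dvd n then a k else 0) < ereal x" for x
    unfolding abs_abscissa_less_iff using lt_ex by blast
  then show ?thesis
    by (meson ereal_bot less_imp_le)
qed

lemma finite_order_on_empty: "finite_order_on f {}"
  unfolding finite_order_on_def by (auto intro: exI[of _ "1::real"])

text \<open>The involution \<open>u \<mapsto> n div u\<close> on the divisors turns
  \<open>u powr s\<close> into \<open>n powr s\<close> times \<open>(n div u) powr (-s)\<close>, so
  the companion is again a divisor sum, with reflected coefficients.\<close>

lemma divisor_sum_in_ODS_space:
  assumes n: "n > 0"
  shows "(\<lambda>s. \<Sum>u | u dvd n. c u * of_nat u powr (-s)) \<in> ODS_space (real n)"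
proof -
  define g where "g s = (\<Sum>u | u dvd n. c (n div u) * of_nat u powr (-s))" for s :: complex
  have "(\<Sum>u | u dvd n. c u * of_nat u powr (-(-s))) = of_real (real n) powr s * g s" for s
  proof -
    have "(\<Sum>u | u dvd n. c u * of_nat u powr (-(-s)))
      = (\<Sum>u | u dvd n. c (n div u) * of_nat (n div u) powr s)"
      using n by (intro sum.reindex_bij_witness[of _ "\<lambda>u. n div u" "\<lambda>u. n div u"]) auto
    also have "\<dots> = (\<Sum>u | u dvd n. of_real (real n) powr s * (c (n div u) * of_nat u powr (-s)))"
    proof (intro sum.cong refl)
      fix u assume u: "u \<in> {u. u dvd n}"
      then obtain v where v: "n = u * v" by auto
      then have "u > 0" "v > 0" using n by auto
      have "(of_nat u * of_nat v :: complex) powr s = of_nat u powr s * of_nat v powr s"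
        using powr_times_real[of "of_nat u" "of_nat v" s] by simp
      then show "c (n div u) * of_nat (n div u) powr s = of_real (real n) powr s * (c (n div u) * of_nat u powr (-s))"
        using \<open>u > 0\<close> by (simp add: v powr_minus field_simps)
    qed
    finally show ?thesis by (simp add: g_def sum_distrib_left)
  qed
  moreover note represented_by_ODS_divisor_sum[OF n, of c]
    represented_by_ODS_divisor_sum[OF n, of "\<lambda>u. c (n div u)", folded g_def]
  moreover have "\<exists>M>0. finite_order_on (\<lambda>s. \<Sum>u | u dvd n. c u * of_nat u powr (-s))
    (order_region (abs_abscissa (\<lambda>k. if k dvd n then c k else 0))
      (abs_abscissa (\<lambda>k. if k dvd n then c (n div k) else 0)) M)"
    unfolding abs_abscissa_finite_support[OF n]
    by (auto simp: order_region_def finite_order_on_empty intro!: exI[of _ "1::real"])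
  ultimately show ?thesis
    unfolding ODS_space_def by blast
qed

text \<open>Nonzero coefficients occur only at divisors of an integral \<open>N\<close>, so the
  series is a finite sum; the identity theorem extends the equality from a right half plane to all
  of the plane.\<close>

lemma ODS_space_elem_eq_divisor_sum:
  assumes "N > 0" "h \<in> ODS_space N"
  obtains "h = (\<lambda>_. 0)"
  | n a where "N = real n" "h = (\<lambda>s. \<Sum>u | u dvd n. a u * of_nat u powr (-s))"
proof -
  obtain a g b M where h: "represented_by_ODS h a" "represented_by_ODS g b" "M > 0"
      "\<And>s. h (-s) = of_real N powr s * g s"
      "finite_order_on h (order_region (abs_abscissa a) (abs_abscissa b) M)"
    using assms(2) unfolding ODS_space_def by blast
  interpret ODS_functional_equation N h g a b
    by unfold_locales (use h assms in auto)
  note nz = coefficient_nonzero_imp[OF h(3,5)]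
  \<comment> \<open>For non-integral \<open>N\<close> all coefficients vanish, so the default 1
    gives a correct, zero, divisor sum and both cases can be treated together.\<close>
  define n where "n = (if N \<in> \<nat> then nat \<lfloor>N\<rfloor> else 1)"
  have n: "n > 0" using assms(1) by (auto simp: n_def Nats_def)
  have an: "a k = (if k dvd n then a k else 0)" if "k > 0" for k
    using nz[OF that] by (cases "a k = 0") (auto simp: n_def)
  define F where "F s = (\<Sum>u | u dvd n. a u * of_nat u powr (-s))" for s :: complex
  obtain \<tau> where \<tau>: "\<And>s. Re s > \<tau> \<Longrightarrow> (\<lambda>n. a (Suc n) * of_nat (Suc n) powr (-s)) sums h s"
    using h(1) unfolding represented_by_ODS_def by blast
  obtain \<tau>' where \<tau>': "\<And>s. Re s > \<tau>' \<Longrightarrow> (\<lambda>k. (if Suc k dvd n then a (Suc k) else 0) * of_nat (Suc k) powr (-s)) sums F s"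
    using represented_by_ODS_divisor_sum[OF n, of a] unfolding represented_by_ODS_def F_def by blast
  have "h = F"
  proof
    fix z
    show "h z = F z"
    proof (rule nicely_meromorphic_identity[where f = h and g = F and S = UNIV and T = "{s. Re s > max \<tau> \<tau>'}"])
      show "h nicely_meromorphic_on UNIV" using h(1) by (simp add: represented_by_ODS_def)
      show "F holomorphic_on UNIV" unfolding F_def by (intro holomorphic_intros)
      show "open {s. Re s > max \<tau> \<tau>'}" by (rule open_halfspace_Re_gt)
      show "{s. Re s > max \<tau> \<tau>'} \<noteq> {}" by (rule right_half_plane_nonempty)
      show "h s = F s" if "s \<in> {s. Re s > max \<tau> \<tau>'}" for s
      proof (rule sums_unique2)
        show "(\<lambda>n. a (Suc n) * of_nat (Suc n) powr (-s)) sums h s" using \<tau> that by simp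
        show "(\<lambda>n. a (Suc n) * of_nat (Suc n) powr (-s)) sums F s"
          using \<tau>'[of s] an that by (simp flip: an)
      qed
    qed auto
  qed
  show ?thesis
  proof (cases "N \<in> \<nat>")
    case True
    then have "N = real n" by (auto simp: n_def Nats_def)
    with \<open>h = F\<close> that(2)[of n a] show ?thesis by (simp add: F_def[abs_def])
  next
    case False
    then have "a u = 0" if "u > 0" for u using nz[OF that] by (auto simp: Nats_def)
    then have "F s = 0" for s
      using n by (auto simp: F_def intro!: sum.neutral)
    with \<open>h = F\<close> that(1) show ?thesis by auto
  qed
qed

text \<open>The zero function satisfies the functional equation with companion 0. Reading it as
  represented by \<open>c\<close>, \<open>coefficients_eq\<close> expresses each \<open>c k\<close>
  through the zero coefficients of the companion.\<close>

lemma dirichlet_polynomial_coeff_unique: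
  assumes n: "n > 0" and eq: "\<And>s::complex. (\<Sum>u | u dvd n. c u * of_nat u powr (-s)) = 0" and "k dvd n"
  shows "c k = 0"
proof -
  define f :: "complex \<Rightarrow> complex" where "f = (\<lambda>s. \<Sum>u | u dvd n. c u * of_nat u powr (-s))"
  have f0: "f = (\<lambda>_. 0)" using eq by (simp add: f_def)
  \<comment> \<open>The zero coefficients are written in this shape to match
    \<open>abs_abscissa_finite_support\<close>.\<close>
  have zero: "represented_by_ODS (\<lambda>_. 0) (\<lambda>k. if k dvd n then 0 else 0)"
    using represented_by_ODS_divisor_sum[OF n, of "\<lambda>_. 0"] by simp
  have "ODS_functional_equation (real n) f (\<lambda>_. 0) (\<lambda>k. if k dvd n then c k else 0) (\<lambda>k. if k dvd n then 0 else 0)"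
    using represented_by_ODS_divisor_sum[OF n, of c, folded f_def] zero n
    by unfold_locales (simp_all add: f0)
  moreover have "finite_order_on f (order_region (abs_abscissa (\<lambda>k. if k dvd n then c k else 0))
      (abs_abscissa (\<lambda>k. if k dvd n then 0 else 0)) 1)"
    unfolding abs_abscissa_finite_support[OF n] by (simp add: order_region_def finite_order_on_empty)
  moreover have "k > 0" using \<open>k dvd n\<close> n by (auto intro: Nat.gr0I)
  ultimately have "(if k dvd n then c k else 0) = (\<Sum>m. if real (Suc m * k) = real n then (if Suc m dvd n then 0 else 0) else 0)"
    by (intro ODS_functional_equation.coefficients_eq[of _ _ _ _ _ 1]) auto
  also have "\<dots> = 0" by (simp cong: if_cong)
  finally show ?thesis using \<open>k dvd n\<close> by simp
qed

section \<open>Span, linear independence and dimension\<close>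

lemma inj_nat_powr: "inj (\<lambda>(u::nat) (s::complex). of_nat u powr (-s) :: complex)"
proof (rule injI)
  fix u v :: nat
  assume "(\<lambda>s::complex. of_nat u powr (-s) :: complex) = (\<lambda>s. of_nat v powr (-s))"
  from fun_cong[OF this, of "-1"] show "u = v" by simp
qed

theorem theorem3:
  fixes N :: real
  assumes "N > 0"
  shows "cfun.subspace (ODS_space N) \<and>
    (\<exists>B. finite B \<and> cfun.span B = ODS_space N) \<and>
    (\<forall>n::nat. N = real n \<longrightarrow>
       ODS_space N = cfun.span {(\<lambda>s. of_nat u powr (-s)) | u::nat. u dvd n}) \<and>
    cfun.dim (ODS_space N) = num_divisors N"
proof -
  define e where "e u = (\<lambda>s::complex. of_nat u powr (-s) :: complex)" for u :: nat
  \<comment> \<open>The existential makes \<open>B\<close> empty for non-integral \<open>N\<close>,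
    so a single set is a basis in both cases.\<close>
  define B where "B = {e u | u. \<exists>n. N = real n \<and> u dvd n}"
  have sum_e: "(\<Sum>u\<in>U. cfun_scale (c u) (e u)) = (\<lambda>s. \<Sum>u\<in>U. c u * of_nat u powr (-s))" for U c
    by (induction U rule: infinite_finite_induct) (auto simp: cfun_scale_def e_def fun_eq_iff)
  have n_pos: "n > 0" if "N = real n" for n using that assms by simp
  have B_eq: "B = e ` {u. u dvd n}" if "N = real n" for n
    using that by (auto simp: B_def)
  have B_empty: "B = {}" if "N \<notin> \<nat>"
    using that by (auto simp: B_def)
  have finB: "finite B"
    using B_eq B_empty n_pos by (cases "N \<in> \<nat>") (auto elim!: Nats_cases)
  \<comment> \<open>Injectivity allows sums over \<open>B\<close> to be reindexed by divisors and
    gives the cardinality of \<open>B\<close>.\<close>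
  have inj: "inj e" unfolding e_def using inj_nat_powr by simp
  have span: "cfun.span B = ODS_space N"
  proof
    show "ODS_space N \<subseteq> cfun.span B"
    proof
      fix h assume "h \<in> ODS_space N"
      with assms show "h \<in> cfun.span B"
      proof (cases rule: ODS_space_elem_eq_divisor_sum)
        case 1
        then show ?thesis using cfun.span_zero by (simp add: zero_fun_def)
      next
        case (2 n a)
        then show ?thesis
          unfolding 2(2) sum_e[symmetric] B_eq[OF 2(1)]
          by (intro cfun.span_sum cfun.span_scale cfun.span_base) auto
      qed
    qed
    show "cfun.span B \<subseteq> ODS_space N"
    proof (cases "N \<in> \<nat>")
      case True
      then obtain n where n: "N = real n" by (auto elim: Nats_cases)
      have fin: "finite {u. u dvd n}" using n_pos[OF n] by simp
      show ?thesis
      proof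
        fix h assume "h \<in> cfun.span B"
        then obtain r where "h = (\<Sum>v\<in>B. cfun_scale (r v) v)"
          using cfun.span_finite[OF finB] by auto
        also have "\<dots> = (\<Sum>u | u dvd n. cfun_scale (r (e u)) (e u))"
          unfolding B_eq[OF n] using inj by (subst sum.reindex) (auto intro: inj_on_subset)
        finally show "h \<in> ODS_space N"
          unfolding sum_e n using divisor_sum_in_ODS_space[OF n_pos[OF n], of "\<lambda>u. r (e u)"] by simp
      qed
    next
      case False
      have zero: "represented_by_ODS (\<lambda>_. 0) (\<lambda>k. if k dvd 1 then 0 else 0)"
        using represented_by_ODS_divisor_sum[of 1 "\<lambda>_. 0"] by simp
      \<comment> \<open>For non-integral \<open>N\<close> the span of the empty set is the zero
        space; the zero function has finite order on every set, whatever the order region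
        is.\<close>
      have "finite_order_on (\<lambda>_. 0) S" for S
        unfolding finite_order_on_def by (rule exI[of _ 1], simp, rule exI[of _ 1], simp)
      then have "(\<lambda>_. 0) \<in> ODS_space N"
        unfolding ODS_space_def using zero
        by (auto intro!: exI[of _ "\<lambda>_. 0"] exI[of _ "\<lambda>k. 0"] exI[of _ "1::real"])
      then show ?thesis using B_empty[OF False] by (simp add: zero_fun_def)
    qed
  qed
  have indep: "\<not> cfun.dependent B"
  proof (cases "N \<in> \<nat>")
    case True
    then obtain n where n: "N = real n" by (auto elim: Nats_cases)
    show ?thesis
      unfolding cfun.dependent_finite[OF finB]
    proof safe
      fix r v assume v: "v \<in> B" "r v \<noteq> 0" and r: "(\<Sum>v\<in>B. cfun_scale (r v) v) = 0"
      have "(\<Sum>u | u dvd n. cfun_scale (r (e u)) (e u)) = (\<Sum>v\<in>B. cfun_scale (r v) v)"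
        unfolding B_eq[OF n] using inj by (subst sum.reindex) (auto intro: inj_on_subset)
      then have "(\<Sum>u | u dvd n. r (e u) * of_nat u powr (-s)) = 0" for s :: complex
        using r unfolding sum_e by (auto simp: fun_eq_iff)
      then have "r (e u) = 0" if "u dvd n" for u
        using dirichlet_polynomial_coeff_unique[OF n_pos[OF n], of "\<lambda>u. r (e u)"] that by blast
      then show False using v B_eq[OF n] by auto
    qed
  qed (simp add: B_empty cfun.independent_empty)
  have "card B = num_divisors N"
  proof (cases "N \<in> \<nat>")
    case True
    then obtain n where n: "N = real n" by (auto elim: Nats_cases)
    then show ?thesis
      using B_eq[OF n] inj by (simp add: num_divisors_def card_image inj_on_subset)
  qed (simp add: B_empty num_divisors_def)
  then have "cfun.dim (ODS_space N) = num_divisors N"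
    using cfun.dim_span_eq_card_independent[OF indep] span by simp
  moreover have "ODS_space N = cfun.span {(\<lambda>s. of_nat u powr (-s)) | u::nat. u dvd n}" if "N = real n" for n
  proof -
    have "{(\<lambda>s. of_nat u powr (-s)) | u::nat. u dvd n} = B"
      unfolding B_eq[OF that] e_def by blast
    then show ?thesis using span by simp
  qed
  \<comment> \<open>Closure under the vector space operations follows from the identification with a
    span.\<close>
  moreover have "cfun.subspace (ODS_space N)"
    using cfun.subspace_span[of B] span by simp
  ultimately show ?thesis
    using finB span by blast
qed

end
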